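(* Let $\mathcal{X}$ be a torsion free Noetherian $\mathbb{F}_1$-scheme with counting function $N(t)\in\mathbb{Z}[t]$. For $n\in\mathbb{N}$ let $M_n:\mathbb{Z}[t]\to\bigoplus_{a\in\mathbb{Z}}\mathbb{Z}\kappa_a(n)$ be the $\mathbb{Z}$-linear map with $M_n(t^a)=\kappa_a(n)$, where $\kappa_a(n):=\frac1n\sum_{m\mid n}\mu\left(\frac nm\right)a^m$ and $\mu$ is the Möbius function. Then \[\zeta_{\mathcal{X}/\mathbb{F}_1}(s)=\left(\frac1s\right)^{N(1)}\prod_{n=1}^\infty \left(1-\left(\frac1s\right)^n\right)^{-M_n(N(t))},\] and this infinite product converges absolutely for $|s|>\deg N$.
   Context: A monoid is a commutative multiplicative monoid with identity $1$ and an absorbing element $0$; $\mathfrak{M}_0$ is the category of monoids, $\mathfrak{CRing}$ that of commutative rings. For a monoid $M$, a prime ideal is a proper subset $\mathfrak{p}\subsetneq M$ with $\mathfrak{p}M\subset\mathfrak{p}$ and $M\setminus\mathfrak{p}$ multiplicatively closed; $\operatorname{spec}M$ is the set of prime ideals with the Zariski topology and the structure sheaf of localisations. A monoid scheme (Deitmar) is a space with a sheaf of monoids locally isomorphic to some $\operatorname{spec}M$. The category $\mathfrak{MR}$ has objects those of $\mathfrak{M}_0$ and $\mathfrak{CRing}$, usual morphisms within each, $\operatorname{Hom}(M,R):=\operatorname{Hom}_{\mathfrak{CRing}}(\mathbb{Z}[M],R)$ and $\operatorname{Hom}(R,M)=\emptyset$. An $\mathbb{F}_1$-scheme (Connes–Consani)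 is a functor $\mathcal{X}:\mathfrak{MR}\to\mathfrak{Set}$ with $\mathcal{X}|_{\mathfrak{M}_0}\cong\operatorname{Hom}(\operatorname{spec}(\cdot),X_{\mathfrak{M}_0})$ for a monoid scheme $X_{\mathfrak{M}_0}$, $\mathcal{X}|_{\mathfrak{CRing}}\cong\operatorname{Hom}(\operatorname{Spec}(\cdot),X_{\mathbb{Z}})$ for a scheme $X_{\mathbb{Z}}$, and such that for every field $K$ the natural map $\mathcal{X}(K\text{ as monoid})\to\mathcal{X}(K)$ is bijective. It is Noetherian if $\mathcal{X}|_{\mathfrak{M}_0}$ is covered by finitely many open subfunctors $\operatorname{Hom}_{\mathfrak{M}_0}(M_i,\cdot)$ with $M_i$ finitely generated and $X_{\mathbb{Z}}$ is Noetherian; torsion free if all $\mathcal{O}_{X_{\mathfrak{M}_0},x}^\times$ are torsion free. For such $\mathcal{X}$, $X_{\mathfrak{M}_0}$ is finite and the counting function is $N(t)=\sum_{x\in X_{\mathfrak{M}_0}}(t-1)^{\operatorname{rank}\mathcal{O}_{X_{\mathfrak{M}_0},x}^\times}$, satisfying $\#X_{\mathbb{Z}}(\mathbb{F}_q)=N(q)$ for all prime powers $q$. The absolute zeta function is $\zeta_{\mathcal{X}/\mathbb{F}_1}(s):=\lim_{p\to1}(p-1)^{N(1)}\exp\left(\sum_{m\ge1}\frac{N(p^m)}{m}p^{-sm}\right)$, which equals $\prod_k(s-k)^{-a_k}$ when $N(t)=\sum_ka_kt^k$. *)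

theory Defs
  imports
    "HOL-Algebra.Ring_Divisibility"
    "HOL-Computational_Algebra.Squarefree"
    "HOL-Number_Theory.Number_Theory"
    "HOL-Complex_Analysis.Complex_Analysis"
begin

section \<open>Commutative monoids with zero\<close>

text \<open>
  An absorbing element is unique, so it is a property of a monoid rather than extra data, and the
  plain monoid records of the library suffice. The trivial monoid, in which 0 = 1, is allowed.
\<close>

definition absorbing :: "('a, 'm) monoid_scheme \<Rightarrow> 'a \<Rightarrow> bool" where
  "absorbing M z \<longleftrightarrow> z \<in> carrier M \<and> (\<forall>x\<in>carrier M. x \<otimes>\<^bsub>M\<^esub> z = z)"

definition monoid0 :: "('a, 'm) monoid_scheme \<Rightarrow> bool" where
  "monoid0 M \<longleftrightarrow> comm_monoid M \<and> (\<exists>z. absorbing M z)"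

definition mzero :: "('a, 'm) monoid_scheme \<Rightarrow> 'a" where
  "mzero M = (THE z. absorbing M z)"

definition monoid0_hom ::
    "('a, 'm) monoid_scheme \<Rightarrow> ('b, 'n) monoid_scheme \<Rightarrow> ('a \<Rightarrow> 'b) set" where
  "monoid0_hom M N =
     {h \<in> hom M N. h \<one>\<^bsub>M\<^esub> = \<one>\<^bsub>N\<^esub> \<and> h (mzero M) = mzero N}"

definition fg_monoid0 :: "('a, 'm) monoid_scheme \<Rightarrow> bool" where
  "fg_monoid0 M \<longleftrightarrow> (\<exists>S. finite S \<and> S \<subseteq> carrier M \<and>
     (\<forall>T. submonoid T M \<and> insert (mzero M) S \<subseteq> T \<longrightarrow> T = carrier M))"

definition monoid0_ideal :: "('a, 'm) monoid_scheme \<Rightarrow> 'a set \<Rightarrow> bool" where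
  "monoid0_ideal M I \<longleftrightarrow> I \<subseteq> carrier M \<and> mzero M \<in> I \<and>
     (\<forall>a\<in>I. \<forall>x\<in>carrier M. a \<otimes>\<^bsub>M\<^esub> x \<in> I)"

text \<open>As usual for monoids with zero, every ideal contains 0; the empty set is not a prime ideal.\<close>

definition monoid0_prime :: "('a, 'm) monoid_scheme \<Rightarrow> 'a set \<Rightarrow> bool" where
  "monoid0_prime M p \<longleftrightarrow> monoid0_ideal M p \<and> p \<noteq> carrier M \<and>
     (\<forall>a\<in>carrier M - p. \<forall>b\<in>carrier M - p. a \<otimes>\<^bsub>M\<^esub> b \<in> carrier M - p)"

text \<open>The monoids obtained from an abelian group by adjoining a zero.\<close>

definition pointed_group :: "('a, 'm) monoid_scheme \<Rightarrow> bool" where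
  "pointed_group M \<longleftrightarrow> monoid0 M \<and> \<one>\<^bsub>M\<^esub> \<noteq> mzero M \<and>
     carrier M - {mzero M} = Units M"

definition mult_monoid :: "('a, 'm) ring_scheme \<Rightarrow> 'a monoid" where
  "mult_monoid R = \<lparr>carrier = carrier R, monoid.mult = monoid.mult R, one = one R\<rparr>"


section \<open>Localisation\<close>

text \<open>
  The construction is the same for monoids and for rings: for rings, u(ta - sb) = 0 is the
  condition uta = usb.
\<close>

definition loc_rel :: "('a, 'm) monoid_scheme \<Rightarrow> 'a set \<Rightarrow> (('a \<times> 'a) \<times> ('a \<times> 'a)) set" where
  "loc_rel M S = {((a, s), (b, t)). a \<in> carrier M \<and> s \<in> S \<and> b \<in> carrier M \<and> t \<in> S \<and>
     (\<exists>u\<in>S. u \<otimes>\<^bsub>M\<^esub> (t \<otimes>\<^bsub>M\<^esub> a) = u \<otimes>\<^bsub>M\<^esub> (s \<otimes>\<^bsub>M\<^esub> b))}"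

definition loc_frac :: "('a, 'm) monoid_scheme \<Rightarrow> 'a set \<Rightarrow> 'a \<Rightarrow> 'a \<Rightarrow> ('a \<times> 'a) set" where
  "loc_frac M S a s = loc_rel M S `` {(a, s)}"

definition loc_carrier :: "('a, 'm) monoid_scheme \<Rightarrow> 'a set \<Rightarrow> ('a \<times> 'a) set set" where
  "loc_carrier M S = {loc_frac M S a s |a s. a \<in> carrier M \<and> s \<in> S}"

definition loc_mult ::
    "('a, 'm) monoid_scheme \<Rightarrow> 'a set \<Rightarrow> ('a \<times> 'a) set \<Rightarrow> ('a \<times> 'a) set \<Rightarrow> ('a \<times> 'a) set" where
  "loc_mult M S x y = (\<Union>(a, s)\<in>x. \<Union>(b, t)\<in>y. loc_frac M S (a \<otimes>\<^bsub>M\<^esub> b) (s \<otimes>\<^bsub>M\<^esub> t))"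

definition loc_add ::
    "('a, 'm) ring_scheme \<Rightarrow> 'a set \<Rightarrow> ('a \<times> 'a) set \<Rightarrow> ('a \<times> 'a) set \<Rightarrow> ('a \<times> 'a) set" where
  "loc_add R S x y = (\<Union>(a, s)\<in>x. \<Union>(b, t)\<in>y.
     loc_frac R S ((a \<otimes>\<^bsub>R\<^esub> t) \<oplus>\<^bsub>R\<^esub> (b \<otimes>\<^bsub>R\<^esub> s)) (s \<otimes>\<^bsub>R\<^esub> t))"

text \<open>The map of localisations induced by a homomorphism sending the denominators into \<open>T\<close>.\<close>

definition loc_map ::
    "('b, 'n) monoid_scheme \<Rightarrow> 'b set \<Rightarrow> ('a \<Rightarrow> 'b) \<Rightarrow> ('a \<times> 'a) set \<Rightarrow> ('b \<times> 'b) set" where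
  "loc_map N T h x = (\<Union>(a, s)\<in>x. loc_frac N T (h a) (h s))"


section \<open>Spaces with a sheaf of monoids or rings\<close>

text \<open>
  Ring records extend monoid records, so one record type serves both for sheaves of monoids and
  for sheaves of rings. The notions below that depend on the kind of structure take the
  predicate for objects or the set of homomorphisms as an argument.
\<close>

record ('p, 's, 'z) structured_space =
  top_of :: "'p topology"
  sections :: "'p set \<Rightarrow> ('s, 'z) monoid_scheme"
  restr :: "'p set \<Rightarrow> 'p set \<Rightarrow> 's \<Rightarrow> 's"

type_synonym ('p, 's) monoidal_space = "('p, 's, unit) structured_space"
type_synonym ('p, 's) ringed_space = "('p, 's, ('s, unit) ring_ext) structured_space"

definition presheaf ::
    "(('s, 'z) monoid_scheme \<Rightarrow> bool) \<Rightarrow>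
     (('s, 'z) monoid_scheme \<Rightarrow> ('s, 'z) monoid_scheme \<Rightarrow> ('s \<Rightarrow> 's) set) \<Rightarrow>
     ('p, 's, 'z) structured_space \<Rightarrow> bool" where
  "presheaf obj homs X \<longleftrightarrow>
     (\<forall>U. openin (top_of X) U \<longrightarrow> obj (sections X U)) \<and>
     (\<forall>U V. openin (top_of X) U \<and> openin (top_of X) V \<and> V \<subseteq> U \<longrightarrow>
        restr X U V \<in> homs (sections X U) (sections X V)) \<and>
     (\<forall>U. openin (top_of X) U \<longrightarrow> (\<forall>s\<in>carrier (sections X U). restr X U U s = s)) \<and>
     (\<forall>U V W. openin (top_of X) U \<and> openin (top_of X) V \<and> openin (top_of X) W \<and>
        W \<subseteq> V \<and> V \<subseteq> U \<longrightarrow>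
        (\<forall>s\<in>carrier (sections X U). restr X V W (restr X U V s) = restr X U W s))"

definition sheaf ::
    "(('s, 'z) monoid_scheme \<Rightarrow> bool) \<Rightarrow>
     (('s, 'z) monoid_scheme \<Rightarrow> ('s, 'z) monoid_scheme \<Rightarrow> ('s \<Rightarrow> 's) set) \<Rightarrow>
     ('p, 's, 'z) structured_space \<Rightarrow> bool" where
  "sheaf obj homs X \<longleftrightarrow> presheaf obj homs X \<and>
     (\<forall>\<U>. (\<forall>U\<in>\<U>. openin (top_of X) U) \<longrightarrow>
        (\<forall>s\<in>carrier (sections X (\<Union>\<U>)). \<forall>t\<in>carrier (sections X (\<Union>\<U>)).
           (\<forall>U\<in>\<U>. restr X (\<Union>\<U>) U s = restr X (\<Union>\<U>) U t) \<longrightarrow> s = t)) \<and>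
     (\<forall>\<U> \<sigma>. (\<forall>U\<in>\<U>. openin (top_of X) U \<and> \<sigma> U \<in> carrier (sections X U)) \<and>
        (\<forall>U\<in>\<U>. \<forall>V\<in>\<U>. restr X U (U \<inter> V) (\<sigma> U) = restr X V (U \<inter> V) (\<sigma> V)) \<longrightarrow>
        (\<exists>s\<in>carrier (sections X (\<Union>\<U>)). \<forall>U\<in>\<U>. restr X (\<Union>\<U>) U s = \<sigma> U))"

definition open_subspace ::
    "('p, 's, 'z) structured_space \<Rightarrow> 'p set \<Rightarrow> ('p, 's, 'z) structured_space" where
  "open_subspace X U =
     \<lparr>top_of = subtopology (top_of X) U, sections = sections X, restr = restr X\<rparr>"

definition germ ::
    "('p, 's, 'z) structured_space \<Rightarrow> 'p \<Rightarrow> 'p set \<Rightarrow> 's \<Rightarrow> ('p set \<times> 's) set" where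
  "germ X x U s = {(V, t). openin (top_of X) V \<and> x \<in> V \<and> t \<in> carrier (sections X V) \<and>
     (\<exists>W. openin (top_of X) W \<and> x \<in> W \<and> W \<subseteq> U \<inter> V \<and> restr X U W s = restr X V W t)}"

text \<open>
  The stalk as a multiplicative monoid. Its units are all that is needed: they give the groups
  whose ranks are counted, and they decide whether a morphism is local.
\<close>

definition stalk :: "('p, 's, 'z) structured_space \<Rightarrow> 'p \<Rightarrow> ('p set \<times> 's) set monoid" where
  "stalk X x =
     \<lparr>carrier = {germ X x U s |U s. openin (top_of X) U \<and> x \<in> U \<and> s \<in> carrier (sections X U)},
      monoid.mult = (\<lambda>A B. \<Union>(U, s)\<in>A. \<Union>(V, t)\<in>B.
        germ X x (U \<inter> V)
          (restr X U (U \<inter> V) s \<otimes>\<^bsub>sections X (U \<inter> V)\<^esub> restr X V (U \<inter> V) t)),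
      one = germ X x (topspace (top_of X)) \<one>\<^bsub>sections X (topspace (top_of X))\<^esub>\<rparr>"

definition preimg ::
    "('p, 's, 'z) structured_space \<Rightarrow> ('p \<Rightarrow> 'q) \<Rightarrow> 'q set \<Rightarrow> 'p set" where
  "preimg X f V = {x \<in> topspace (top_of X). f x \<in> V}"

text \<open>
  Local morphisms, as pairs of a continuous map and its comorphism. All components are
  extensional, so that equal morphisms are equal as elements of the type and the sets of
  morphisms have the right size.
\<close>

definition local_morphisms ::
    "(('t, 'y) monoid_scheme \<Rightarrow> ('s, 'z) monoid_scheme \<Rightarrow> ('t \<Rightarrow> 's) set) \<Rightarrow>
     ('p, 's, 'z) structured_space \<Rightarrow> ('q, 't, 'y) structured_space \<Rightarrow>
     (('p \<Rightarrow> 'q) \<times> ('q set \<Rightarrow> 't \<Rightarrow> 's)) set" where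
  "local_morphisms homs X Y = {(f, \<phi>).
     f \<in> extensional (topspace (top_of X)) \<and>
     continuous_map (top_of X) (top_of Y) f \<and>
     \<phi> \<in> extensional {V. openin (top_of Y) V} \<and>
     (\<forall>V. openin (top_of Y) V \<longrightarrow>
        \<phi> V \<in> extensional (carrier (sections Y V)) \<and>
        \<phi> V \<in> homs (sections Y V) (sections X (preimg X f V))) \<and>
     (\<forall>V W. openin (top_of Y) V \<and> openin (top_of Y) W \<and> W \<subseteq> V \<longrightarrow>
        (\<forall>t\<in>carrier (sections Y V).
           \<phi> W (restr Y V W t) = restr X (preimg X f V) (preimg X f W) (\<phi> V t))) \<and>
     (\<forall>x\<in>topspace (top_of X). \<forall>V. openin (top_of Y) V \<and> f x \<in> V \<longrightarrow>
        (\<forall>t\<in>carrier (sections Y V).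
           germ X x (preimg X f V) (\<phi> V t) \<in> Units (stalk X x) \<longrightarrow>
           germ Y (f x) V t \<in> Units (stalk Y (f x))))}"

text \<open>\<open>comp_morphism W X Y (g, \<psi>) (f, \<phi>)\<close> is the composite of \<open>(f, \<phi>) : W \<rightarrow> X\<close> and \<open>(g, \<psi>) : X \<rightarrow> Y\<close>.\<close>

definition comp_morphism ::
    "('o, 'r, 'x) structured_space \<Rightarrow> ('p, 's, 'z) structured_space \<Rightarrow>
     ('q, 't, 'y) structured_space \<Rightarrow>
     ('p \<Rightarrow> 'q) \<times> ('q set \<Rightarrow> 't \<Rightarrow> 's) \<Rightarrow> ('o \<Rightarrow> 'p) \<times> ('p set \<Rightarrow> 's \<Rightarrow> 'r) \<Rightarrow>
     ('o \<Rightarrow> 'q) \<times> ('q set \<Rightarrow> 't \<Rightarrow> 'r)" where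
  "comp_morphism W X Y G F =
     (compose (topspace (top_of W)) (fst G) (fst F),
      \<lambda>V\<in>{V. openin (top_of Y) V}. \<lambda>t\<in>carrier (sections Y V).
        snd F (preimg X (fst G) V) (snd G V t))"

definition isomorphic_spaces ::
    "(('t, 'y) monoid_scheme \<Rightarrow> ('s, 'z) monoid_scheme \<Rightarrow> ('t \<Rightarrow> 's) set) \<Rightarrow>
     ('p, 's, 'z) structured_space \<Rightarrow> ('q, 't, 'y) structured_space \<Rightarrow> bool" where
  "isomorphic_spaces homs X Y \<longleftrightarrow> (\<exists>(f, \<phi>) \<in> local_morphisms homs X Y.
     homeomorphic_map (top_of X) (top_of Y) f \<and>
     (\<forall>V. openin (top_of Y) V \<longrightarrow>
        bij_betw (\<phi> V) (carrier (sections Y V)) (carrier (sections X (preimg X f V)))))"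


section \<open>Spectra\<close>

definition zariski :: "('a, 'm) monoid_scheme \<Rightarrow> 'a set set \<Rightarrow> 'a set topology" where
  "zariski M P = topology_generated_by {{p \<in> P. a \<notin> p} |a. a \<in> carrier M}"

text \<open>Sections over \<open>U\<close> are the functions into the localisations that are locally fractions.\<close>

definition spec_sections ::
    "('a, 'm) monoid_scheme \<Rightarrow> 'a set set \<Rightarrow> 'a set set \<Rightarrow> ('a set \<Rightarrow> ('a \<times> 'a) set) set" where
  "spec_sections M P U =
     {\<sigma> \<in> (\<Pi>\<^sub>E p\<in>U. loc_carrier M (carrier M - p)).
        \<forall>p\<in>U. \<exists>V. openin (zariski M P) V \<and> p \<in> V \<and> V \<subseteq> U \<and>
          (\<exists>a\<in>carrier M. \<exists>s\<in>carrier M. \<forall>q\<in>V. s \<notin> q \<and> \<sigma> q = loc_frac M (carrier M - q) a s)}"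

definition mspec ::
    "('a, 'm) monoid_scheme \<Rightarrow> ('a set, 'a set \<Rightarrow> ('a \<times> 'a) set) monoidal_space" where
  "mspec M =
     \<lparr>top_of = zariski M {p. monoid0_prime M p},
      sections = (\<lambda>U.
        \<lparr>carrier = spec_sections M {p. monoid0_prime M p} U,
         monoid.mult = (\<lambda>\<sigma> \<tau>. \<lambda>p\<in>U. loc_mult M (carrier M - p) (\<sigma> p) (\<tau> p)),
         one = (\<lambda>p\<in>U. loc_frac M (carrier M - p) \<one>\<^bsub>M\<^esub> \<one>\<^bsub>M\<^esub>)\<rparr>),
      restr = (\<lambda>U V \<sigma>. restrict \<sigma> V)\<rparr>"

definition rspec ::
    "('a, 'm) ring_scheme \<Rightarrow> ('a set, 'a set \<Rightarrow> ('a \<times> 'a) set) ringed_space" where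
  "rspec R =
     \<lparr>top_of = zariski R {p. primeideal p R},
      sections = (\<lambda>U.
        \<lparr>carrier = spec_sections R {p. primeideal p R} U,
         monoid.mult = (\<lambda>\<sigma> \<tau>. \<lambda>p\<in>U. loc_mult R (carrier R - p) (\<sigma> p) (\<tau> p)),
         one = (\<lambda>p\<in>U. loc_frac R (carrier R - p) \<one>\<^bsub>R\<^esub> \<one>\<^bsub>R\<^esub>),
         zero = (\<lambda>p\<in>U. loc_frac R (carrier R - p) \<zero>\<^bsub>R\<^esub> \<one>\<^bsub>R\<^esub>),
         add = (\<lambda>\<sigma> \<tau>. \<lambda>p\<in>U. loc_add R (carrier R - p) (\<sigma> p) (\<tau> p))\<rparr>),
      restr = (\<lambda>U V \<sigma>. restrict \<sigma> V)\<rparr>"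

text \<open>
  The morphism from the spectrum \<open>Y\<close> of \<open>N\<close> to the spectrum \<open>X\<close> of \<open>M\<close> induced by \<open>h : M \<rightarrow> N\<close>.
\<close>

definition spec_map ::
    "('a, 'm) monoid_scheme \<Rightarrow> ('b, 'n) monoid_scheme \<Rightarrow>
     ('a set, 'a set \<Rightarrow> ('a \<times> 'a) set, 'z) structured_space \<Rightarrow>
     ('b set, 'b set \<Rightarrow> ('b \<times> 'b) set, 'y) structured_space \<Rightarrow> ('a \<Rightarrow> 'b) \<Rightarrow>
     ('b set \<Rightarrow> 'a set) \<times>
     ('a set set \<Rightarrow> ('a set \<Rightarrow> ('a \<times> 'a) set) \<Rightarrow> ('b set \<Rightarrow> ('b \<times> 'b) set))" where
  "spec_map M N X Y h =
     (let f = (\<lambda>q\<in>topspace (top_of Y). {a \<in> carrier M. h a \<in> q}) in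
      (f, \<lambda>V\<in>{V. openin (top_of X) V}. \<lambda>\<sigma>\<in>carrier (sections X V).
            \<lambda>q\<in>preimg Y f V. loc_map N (carrier N - q) h (\<sigma> (f q))))"


section \<open>Monoid schemes and schemes\<close>

text \<open>
  If an open subspace is isomorphic to the spectrum of \<open>A\<close>, then \<open>A\<close> is isomorphic to the monoid
  (or ring) of sections over it; hence it is no restriction to take \<open>A\<close> on the type of sections.
\<close>

definition monoid_scheme_space :: "('p, 's) monoidal_space \<Rightarrow> bool" where
  "monoid_scheme_space X \<longleftrightarrow> sheaf monoid0 monoid0_hom X \<and>
     (\<forall>x\<in>topspace (top_of X). \<exists>U. openin (top_of X) U \<and> x \<in> U \<and>
        (\<exists>A :: 's monoid. monoid0 A \<and>
           isomorphic_spaces monoid0_hom (open_subspace X U) (mspec A)))"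

definition ring_scheme_space :: "('p, 's) ringed_space \<Rightarrow> bool" where
  "ring_scheme_space X \<longleftrightarrow> sheaf cring ring_hom X \<and>
     (\<forall>x\<in>topspace (top_of X). \<exists>U. openin (top_of X) U \<and> x \<in> U \<and>
        (\<exists>A :: 's ring. cring A \<and>
           isomorphic_spaces ring_hom (open_subspace X U) (rspec A)))"

definition noetherian_ring_scheme :: "('p, 's) ringed_space \<Rightarrow> bool" where
  "noetherian_ring_scheme X \<longleftrightarrow> ring_scheme_space X \<and>
     (\<exists>\<U>. finite \<U> \<and> \<Union>\<U> = topspace (top_of X) \<and>
        (\<forall>U\<in>\<U>. openin (top_of X) U \<and>
          (\<exists>A :: 's ring. cring A \<and> noetherian_ring A \<and>
             isomorphic_spaces ring_hom (open_subspace X U) (rspec A))))"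


section \<open>The category of monoids and rings\<close>

text \<open>
  The monoid ring over the integers, with the zero of the monoid identified with 0: finitely
  supported functions on the nonzero elements. This is the left adjoint of the forgetful functor
  from rings to monoids with zero.
\<close>

definition monoid_ring :: "('a, 'm) monoid_scheme \<Rightarrow> ('a \<Rightarrow> int) ring" where
  "monoid_ring M =
     \<lparr>carrier = {c. finite {x. c x \<noteq> 0} \<and> {x. c x \<noteq> 0} \<subseteq> carrier M - {mzero M}},
      monoid.mult = (\<lambda>c d x. if x \<in> carrier M - {mzero M}
        then \<Sum>(a, b) \<in> {(a, b). c a \<noteq> 0 \<and> d b \<noteq> 0 \<and> a \<otimes>\<^bsub>M\<^esub> b = x}. c a * d b else 0),
      one = (\<lambda>x. if x = \<one>\<^bsub>M\<^esub> \<and> x \<noteq> mzero M then 1 else 0),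
      zero = (\<lambda>x. 0),
      add = (\<lambda>c d x. c x + d x)\<rparr>"

definition monoid_ring_map ::
    "('b, 'n) monoid_scheme \<Rightarrow> ('a \<Rightarrow> 'b) \<Rightarrow> ('a \<Rightarrow> int) \<Rightarrow> ('b \<Rightarrow> int)" where
  "monoid_ring_map N h c = (\<lambda>y. if y \<in> carrier N - {mzero N}
     then \<Sum>x \<in> {x. c x \<noteq> 0 \<and> h x = y}. c x else 0)"

datatype 'u MR_obj = Mon "'u monoid" | Rng "'u ring"

datatype 'u MR_mor = MonMor "'u \<Rightarrow> 'u" | RngMor "'u \<Rightarrow> 'u" | MixMor "('u \<Rightarrow> int) \<Rightarrow> 'u"

text \<open>
  The type \<open>'u\<close> plays the role of the universe from which the monoids and rings are taken.
\<close>

fun MR_object :: "'u MR_obj \<Rightarrow> bool" where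
  "MR_object (Mon M) = monoid0 M"
| "MR_object (Rng R) = cring R"

fun MR_hom :: "'u MR_obj \<Rightarrow> 'u MR_obj \<Rightarrow> 'u MR_mor set" where
  "MR_hom (Mon M) (Mon N) = MonMor ` (monoid0_hom M N \<inter> extensional (carrier M))"
| "MR_hom (Rng R) (Rng S) = RngMor ` (ring_hom R S \<inter> extensional (carrier R))"
| "MR_hom (Mon M) (Rng R) =
     MixMor ` (ring_hom (monoid_ring M) R \<inter> extensional (carrier (monoid_ring M)))"
| "MR_hom (Rng R) (Mon M) = {}"

fun MR_id :: "'u MR_obj \<Rightarrow> 'u MR_mor" where
  "MR_id (Mon M) = MonMor (\<lambda>x\<in>carrier M. x)"
| "MR_id (Rng R) = RngMor (\<lambda>x\<in>carrier R. x)"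

text \<open>\<open>MR_comp A B g f\<close> is the composite of \<open>f : A \<rightarrow> B\<close> and a morphism \<open>g\<close> with source \<open>B\<close>.\<close>

fun MR_comp :: "'u MR_obj \<Rightarrow> 'u MR_obj \<Rightarrow> 'u MR_mor \<Rightarrow> 'u MR_mor \<Rightarrow> 'u MR_mor" where
  "MR_comp (Mon M) (Mon N) (MonMor g) (MonMor f) = MonMor (compose (carrier M) g f)"
| "MR_comp (Rng R) (Rng S) (RngMor g) (RngMor f) = RngMor (compose (carrier R) g f)"
| "MR_comp (Mon M) (Mon N) (MixMor g) (MonMor f) =
     MixMor (compose (carrier (monoid_ring M)) g (monoid_ring_map N f))"
| "MR_comp (Mon M) (Rng R) (RngMor g) (MixMor f) =
     MixMor (compose (carrier (monoid_ring M)) g f)"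
| "MR_comp _ _ _ _ = undefined"

record ('u, 'x) MR_functor =
  Fob :: "'u MR_obj \<Rightarrow> 'x set"
  Fmor :: "'u MR_obj \<Rightarrow> 'u MR_obj \<Rightarrow> 'u MR_mor \<Rightarrow> 'x \<Rightarrow> 'x"

definition is_MR_functor :: "('u, 'x) MR_functor \<Rightarrow> bool" where
  "is_MR_functor F \<longleftrightarrow>
     (\<forall>A B f. MR_object A \<and> MR_object B \<and> f \<in> MR_hom A B \<longrightarrow>
        Fmor F A B f \<in> Fob F A \<rightarrow> Fob F B) \<and>
     (\<forall>A. MR_object A \<longrightarrow> (\<forall>x\<in>Fob F A. Fmor F A A (MR_id A) x = x)) \<and>
     (\<forall>A B C f g. MR_object A \<and> MR_object B \<and> MR_object C \<and>
        f \<in> MR_hom A B \<and> g \<in> MR_hom B C \<longrightarrow>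
        (\<forall>x\<in>Fob F A. Fmor F A C (MR_comp A B g f) x = Fmor F B C g (Fmor F A B f x)))"


section \<open>F1-schemes\<close>

definition represented_on_monoids ::
    "('u, 'x) MR_functor \<Rightarrow> ('p, 's) monoidal_space \<Rightarrow> bool" where
  "represented_on_monoids F X \<longleftrightarrow> (\<exists>\<eta>.
     (\<forall>M. monoid0 M \<longrightarrow> bij_betw (\<eta> M) (Fob F (Mon M)) (local_morphisms monoid0_hom (mspec M) X)) \<and>
     (\<forall>M N h. monoid0 M \<and> monoid0 N \<and> MonMor h \<in> MR_hom (Mon M) (Mon N) \<longrightarrow>
        (\<forall>x\<in>Fob F (Mon M). \<eta> N (Fmor F (Mon M) (Mon N) (MonMor h) x) =
           comp_morphism (mspec N) (mspec M) X (\<eta> M x) (spec_map M N (mspec M) (mspec N) h))))"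

definition represented_on_rings ::
    "('u, 'x) MR_functor \<Rightarrow> ('p, 's) ringed_space \<Rightarrow> bool" where
  "represented_on_rings F X \<longleftrightarrow> (\<exists>\<eta>.
     (\<forall>R. cring R \<longrightarrow> bij_betw (\<eta> R) (Fob F (Rng R)) (local_morphisms ring_hom (rspec R) X)) \<and>
     (\<forall>R S h. cring R \<and> cring S \<and> RngMor h \<in> MR_hom (Rng R) (Rng S) \<longrightarrow>
        (\<forall>x\<in>Fob F (Rng R). \<eta> S (Fmor F (Rng R) (Rng S) (RngMor h) x) =
           comp_morphism (rspec S) (rspec R) X (\<eta> R x) (spec_map R S (rspec R) (rspec S) h))))"

text \<open>The canonical morphism from the multiplicative monoid of a ring to the ring.\<close>

definition eval_mor :: "'u ring \<Rightarrow> 'u MR_mor" where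
  "eval_mor R = MixMor (\<lambda>c\<in>carrier (monoid_ring (mult_monoid R)).
     \<Oplus>\<^bsub>R\<^esub>a\<in>{a. c a \<noteq> 0}. [c a] \<cdot>\<^bsub>R\<^esub> a)"

text \<open>
  \<open>XM\<close> and \<open>XZ\<close> are the monoid scheme and the scheme that represent the two restrictions of the
  functor. The universe is infinite, so that it has room for all finite fields and all finitely
  generated monoids.
\<close>

definition F1_scheme ::
    "('u, 'x) MR_functor \<Rightarrow> ('p, 's) monoidal_space \<Rightarrow> ('q, 't) ringed_space \<Rightarrow> bool" where
  "F1_scheme F XM XZ \<longleftrightarrow>
     infinite (UNIV :: 'u set) \<and>
     is_MR_functor F \<and>
     monoid_scheme_space XM \<and> represented_on_monoids F XM \<and>
     ring_scheme_space XZ \<and> represented_on_rings F XZ \<and>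
     (\<forall>K. field K \<longrightarrow>
        bij_betw (Fmor F (Mon (mult_monoid K)) (Rng K) (eval_mor K))
          (Fob F (Mon (mult_monoid K))) (Fob F (Rng K)))"

definition monoid_subfunctor ::
    "('u, 'x) MR_functor \<Rightarrow> ('u monoid \<Rightarrow> 'x set) \<Rightarrow> bool" where
  "monoid_subfunctor F Y \<longleftrightarrow>
     (\<forall>M. monoid0 M \<longrightarrow> Y M \<subseteq> Fob F (Mon M)) \<and>
     (\<forall>M N f. monoid0 M \<and> monoid0 N \<and> f \<in> MR_hom (Mon M) (Mon N) \<longrightarrow>
        Fmor F (Mon M) (Mon N) f \<in> Y M \<rightarrow> Y N)"

text \<open>
  Openness in the sense of Connes and Consani: the inverse image under the transformation
  \<open>Hom(M, -) \<rightarrow> F\<close> given by any \<open>x\<close> in \<open>F(M)\<close> is cut out by an ideal of \<open>M\<close>.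
\<close>

definition open_subfunctor ::
    "('u, 'x) MR_functor \<Rightarrow> ('u monoid \<Rightarrow> 'x set) \<Rightarrow> bool" where
  "open_subfunctor F Y \<longleftrightarrow> monoid_subfunctor F Y \<and>
     (\<forall>M. monoid0 M \<longrightarrow> (\<forall>x\<in>Fob F (Mon M). \<exists>I. monoid0_ideal M I \<and>
        (\<forall>N h. monoid0 N \<and> MonMor h \<in> MR_hom (Mon M) (Mon N) \<longrightarrow>
           (Fmor F (Mon M) (Mon N) (MonMor h) x \<in> Y N \<longleftrightarrow>
            {h a \<otimes>\<^bsub>N\<^esub> b |a b. a \<in> I \<and> b \<in> carrier N} = carrier N))))"

definition represented_by_monoid ::
    "('u, 'x) MR_functor \<Rightarrow> ('u monoid \<Rightarrow> 'x set) \<Rightarrow> 'u monoid \<Rightarrow> bool" where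
  "represented_by_monoid F Y M \<longleftrightarrow> (\<exists>\<theta>.
     (\<forall>N. monoid0 N \<longrightarrow> bij_betw (\<theta> N) (MR_hom (Mon M) (Mon N)) (Y N)) \<and>
     (\<forall>N N' f g. monoid0 N \<and> monoid0 N' \<and>
        f \<in> MR_hom (Mon M) (Mon N) \<and> g \<in> MR_hom (Mon N) (Mon N') \<longrightarrow>
        \<theta> N' (MR_comp (Mon M) (Mon N) g f) = Fmor F (Mon N) (Mon N') g (\<theta> N f)))"

text \<open>
  A family of open subfunctors is a covering in the sense of Connes and Consani if it exhausts
  the values of the functor at abelian groups with a zero adjoined, which play the role of fields.
\<close>

definition noetherian_F1_scheme ::
    "('u, 'x) MR_functor \<Rightarrow> ('p, 's) monoidal_space \<Rightarrow> ('q, 't) ringed_space \<Rightarrow> bool" where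
  "noetherian_F1_scheme F XM XZ \<longleftrightarrow> F1_scheme F XM XZ \<and>
     (\<exists>\<Y>. finite \<Y> \<and>
        (\<forall>Y\<in>\<Y>. open_subfunctor F Y \<and>
           (\<exists>M. monoid0 M \<and> fg_monoid0 M \<and> represented_by_monoid F Y M)) \<and>
        (\<forall>H. pointed_group H \<longrightarrow> Fob F (Mon H) = (\<Union>Y\<in>\<Y>. Y H))) \<and>
     noetherian_ring_scheme XZ"

definition torsion_free_group :: "('a, 'm) monoid_scheme \<Rightarrow> bool" where
  "torsion_free_group G \<longleftrightarrow>
     (\<forall>u\<in>carrier G. \<forall>n::nat. n > 0 \<and> u [^]\<^bsub>G\<^esub> n = \<one>\<^bsub>G\<^esub> \<longrightarrow> u = \<one>\<^bsub>G\<^esub>)"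

definition torsion_free_F1_scheme :: "('p, 's) monoidal_space \<Rightarrow> bool" where
  "torsion_free_F1_scheme XM \<longleftrightarrow>
     (\<forall>x\<in>topspace (top_of XM). torsion_free_group (units_of (stalk XM x)))"


section \<open>Counting function and absolute zeta function\<close>

definition independent_in_group :: "('a, 'm) monoid_scheme \<Rightarrow> 'a set \<Rightarrow> bool" where
  "independent_in_group G B \<longleftrightarrow> finite B \<and> B \<subseteq> carrier G \<and>
     (\<forall>c :: 'a \<Rightarrow> int. (\<Otimes>\<^bsub>G\<^esub>b\<in>B. b [^]\<^bsub>G\<^esub> c b) = \<one>\<^bsub>G\<^esub> \<longrightarrow> (\<forall>b\<in>B. c b = 0))"

definition abelian_rank :: "('a, 'm) monoid_scheme \<Rightarrow> nat" where
  "abelian_rank G = Sup (card ` {B. independent_in_group G B})"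

definition counting_function :: "('p, 's) monoidal_space \<Rightarrow> int poly" where
  "counting_function XM =
     (\<Sum>x\<in>topspace (top_of XM). [:-1, 1:] ^ abelian_rank (units_of (stalk XM x)))"

definition zeta_approx :: "int poly \<Rightarrow> complex \<Rightarrow> real \<Rightarrow> complex" where
  "zeta_approx N s p =
     (of_real p - 1) powi (poly N 1) *
     exp (\<Sum>m. poly (map_poly of_int N) (of_real p ^ Suc m) / of_nat (Suc m) *
                of_real p powr (- s * of_nat (Suc m)))"

text \<open>
  For \<open>p > 1\<close> the inner series converges absolutely if and only if \<open>Re s > deg N\<close> (unless
  \<open>N = 0\<close>), and it diverges for \<open>Re s < deg N\<close>. So the defining limit determines the zeta function on that half-plane, and elsewhere it is given by
  meromorphic continuation. Nicely meromorphic functions are continuous away from their poles,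
  where they are 0 by convention, which makes the continuation unique as a total function.
\<close>

definition absolute_zeta :: "int poly \<Rightarrow> complex \<Rightarrow> complex" where
  "absolute_zeta N = (THE Z. Z nicely_meromorphic_on UNIV \<and>
     (\<forall>s. Re s > real (degree N) \<longrightarrow> (zeta_approx N s \<longlongrightarrow> Z s) (at_right 1)))"


section \<open>Necklace polynomials\<close>

definition moebius_mu :: "nat \<Rightarrow> int" where
  "moebius_mu n = (if squarefree n then (-1) ^ card (prime_factors n) else 0)"

text \<open>The division by \<open>n\<close> is exact; see \<open>of_int_kappa\<close> below.\<close>

definition kappa :: "int \<Rightarrow> nat \<Rightarrow> int" where
  "kappa a n = (\<Sum>m | m dvd n. moebius_mu (n div m) * a ^ m) div int n"

definition necklace_map :: "nat \<Rightarrow> int poly \<Rightarrow> int" where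
  "necklace_map n P = (\<Sum>a\<le>degree P. coeff P a * kappa (int a) n)"

lemma cong_power_lift:
  fixes x y :: int
  assumes "[x = y] (mod int p ^ j)" "j > 0" "p > 0"
  shows "[x ^ p = y ^ p] (mod int p ^ Suc j)"
proof -
  have "int p dvd int p ^ j" using assms(2) by (simp add: dvd_power)
  then have xy: "[x = y] (mod int p)" using assms(1) cong_dvd_modulus by blast
  have "[(\<Sum>i<p. x ^ i * y ^ (p - Suc i)) = (\<Sum>i<p. y ^ i * y ^ (p - Suc i))] (mod int p)"
    by (intro cong_sum cong_mult cong_pow xy) auto
  moreover have "(\<Sum>i<p. y ^ i * y ^ (p - Suc i)) = (\<Sum>i<p. y ^ (p - 1))"
    by (intro sum.cong refl) (simp flip: power_add)
  ultimately have "int p dvd (\<Sum>i<p. x ^ i * y ^ (p - Suc i))"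
    by (simp add: cong_dvd_iff)
  moreover have "int p ^ j dvd x - y" using assms(1) by (simp add: cong_iff_dvd_diff)
  ultimately have "int p ^ j * int p dvd (x - y) * (\<Sum>i<p. x ^ i * y ^ (p - Suc i))"
    by (rule mult_dvd_mono[rotated])
  moreover have "x ^ p - y ^ p = (x - y) * (\<Sum>i<p. x ^ i * y ^ (p - Suc i))"
    by (subst power_diff_sumr2) (simp add: mult.commute)
  ultimately show ?thesis by (simp add: cong_iff_dvd_diff mult.commute)
qed

lemma fermat_cong_int:
  fixes b :: int assumes "prime p" shows "[b ^ p = b] (mod int p)"
proof -
  define c where "c = nat (b mod int p)"
  have p0: "p > 0" using assms by (rule prime_gt_0_nat)
  then have bc: "[b = int c] (mod int p)" by (simp add: c_def cong_def)
  have "[c ^ p = c] (mod p)"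
  proof (cases "p dvd c")
    case True
    moreover have "p dvd c ^ p" using True p0 by (metis dvd_power dvd_trans)
    ultimately show ?thesis by (metis cong_0_iff cong_sym cong_trans)
  next
    case False
    from fermat_theorem[OF assms False] have "[c * c ^ (p - 1) = c * 1] (mod p)"
      by (rule cong_scalar_left)
    then show ?thesis using p0 by (simp flip: power_Suc)
  qed
  then have "[int c ^ p = int c] (mod int p)" by (metis cong_int_iff of_nat_power)
  then show ?thesis using bc by (metis cong_pow cong_sym cong_trans)
qed

lemma cong_prime_power:
  fixes b :: int assumes "prime p"
  shows "[b ^ (p ^ Suc k) = b ^ (p ^ k)] (mod int p ^ Suc k)"
proof (induction k)
  case 0 then show ?case using fermat_cong_int[OF assms] by simp
next
  case (Suc k)
  from cong_power_lift[OF Suc] prime_gt_0_nat[OF assms]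
  show ?case by (simp add: power_mult[symmetric] mult.commute)
qed

lemma moebius_mu_prime_mult:
  assumes "prime p" "\<not> p dvd e" shows "moebius_mu (p * e) = - moebius_mu e"
proof -
  have c: "coprime p e" using assms by (simp add: prime_imp_coprime_nat)
  have "e \<noteq> 0" using assms(2) by (metis dvd_0_right)
  have "prime_factors (p * e) = insert p (prime_factors e)"
    using assms \<open>e \<noteq> 0\<close> by (simp add: prime_factors_product prime_prime_factors)
  moreover have "p \<notin> prime_factors e" using assms by auto
  moreover have "squarefree (p * e) \<longleftrightarrow> squarefree e"
    using c squarefree_mult_coprime[OF c] squarefree_prime[OF assms(1)] squarefree_multD(2) by blast
  ultimately show ?thesis by (simp add: moebius_mu_def)
qed

lemma moebius_mu_not_squarefree: "prime p \<Longrightarrow> p ^ 2 dvd e \<Longrightarrow> moebius_mu e = 0"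
  by (auto simp: moebius_mu_def squarefree_def)

lemma gauss_congruence_prime_power:
  fixes a :: int
  assumes p: "prime p" and m: "\<not> p dvd m" and n: "n = p ^ Suc k * m"
  shows "int p ^ Suc k dvd (\<Sum>e | e dvd n. moebius_mu e * a ^ (n div e))"
proof -
  have m0: "m > 0" and p0: "p > 0" using m p by (auto intro!: Nat.gr0I simp: prime_gt_0_nat)
  have n0: "n > 0" using n m0 p0 by simp
  let ?D = "{e. e dvd m}" and ?g = "\<lambda>e. moebius_mu e * a ^ (n div e)"
  have fin: "finite ?D" using m0 by simp
  have inj: "inj_on ((*) p) ?D" using p0 by (auto simp: inj_on_def)
  have disj: "?D \<inter> (*) p ` ?D = {}" using m by (auto dest: dvd_mult_left)
  have "(\<Sum>e | e dvd n. ?g e) = (\<Sum>e\<in>?D \<union> (*) p ` ?D. ?g e)"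
  proof (rule sum.mono_neutral_right)
    show "finite {e. e dvd n}" using n0 by simp
    show "?D \<union> (*) p ` ?D \<subseteq> {e. e dvd n}" using n by (auto intro: mult_dvd_mono)
    show "\<forall>e\<in>{e. e dvd n} - (?D \<union> (*) p ` ?D). ?g e = 0"
    proof
      fix e assume e: "e \<in> {e. e dvd n} - (?D \<union> (*) p ` ?D)"
      have "p ^ 2 dvd e"
      proof (rule ccontr)
        assume sq: "\<not> p ^ 2 dvd e"
        show False
        proof (cases "p dvd e")
          case False
          then have "coprime e (p ^ Suc k)" using p
            by (metis coprime_commute coprime_power_right_iff prime_imp_coprime_nat)
          then have "e dvd m" using e n by (simp add: coprime_dvd_mult_right_iff)
          then show False using e by auto
        next
          case True
          then obtain f where f: "e = p * f" by auto
          then have "\<not> p dvd f" using sq by (auto simp: power2_eq_square)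
          then have "coprime f (p ^ Suc k)" using p
            by (metis coprime_commute coprime_power_right_iff prime_imp_coprime_nat)
          moreover have "f dvd p ^ Suc k * m" using e f n by (metis DiffE dvd_mult_right mem_Collect_eq)
          ultimately have "f dvd m" by (simp add: coprime_dvd_mult_right_iff)
          then show False using e f by auto
        qed
      qed
      then show "?g e = 0" using moebius_mu_not_squarefree[OF p] by simp
    qed
  qed
  also have "\<dots> = (\<Sum>e\<in>?D. ?g e) + (\<Sum>e\<in>?D. ?g (p * e))"
    using fin disj inj by (subst sum.union_disjoint) (auto simp: sum.reindex)
  also have "\<dots> = (\<Sum>e\<in>?D. ?g e + ?g (p * e))" by (simp add: sum.distrib)
  also have "int p ^ Suc k dvd \<dots>"
  proof (rule dvd_sum)
    fix e assume "e \<in> ?D"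
    then obtain f where f: "m = e * f" by auto
    then have e: "e > 0" "\<not> p dvd e" using m m0 by auto
    have "n div e = f * p ^ Suc k" using n f e by (simp add: ac_simps)
    moreover have "n div (p * e) = f * p ^ k"
    proof -
      have "n = (p * e) * (f * p ^ k)" using n f by (simp add: ac_simps)
      then show ?thesis using e p0 by (metis nonzero_mult_div_cancel_left mult_is_0 not_gr_zero)
    qed
    ultimately have "?g e + ?g (p * e) = moebius_mu e * ((a ^ f) ^ (p ^ Suc k) - (a ^ f) ^ (p ^ k))"
      using moebius_mu_prime_mult[OF p e(2)] by (simp add: power_mult[symmetric] algebra_simps)
    then show "int p ^ Suc k dvd ?g e + ?g (p * e)"
      using cong_prime_power[OF p, of "a ^ f" k] by (simp add: cong_iff_dvd_diff)
  qed
  finally show ?thesis .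
qed

lemma gauss_congruence:
  fixes a :: int assumes n0: "n > 0"
  shows "int n dvd (\<Sum>m | m dvd n. moebius_mu (n div m) * a ^ m)"
proof -
  have eq: "(\<Sum>m | m dvd n. moebius_mu (n div m) * a ^ m) = (\<Sum>e | e dvd n. moebius_mu e * a ^ (n div e))"
    by (rule sum.reindex_bij_witness[of _ "\<lambda>e. n div e" "\<lambda>e. n div e"]) (use n0 in auto)
  let ?S = "nat \<bar>\<Sum>e | e dvd n. moebius_mu e * a ^ (n div e)\<bar>"
  have "n dvd ?S"
  proof (cases "?S = 0")
    case False
    show ?thesis
    proof (rule multiplicity_le_imp_dvd)
      fix p :: nat assume p: "prime p"
      show "multiplicity p n \<le> multiplicity p ?S"
      proof (cases "multiplicity p n")
        case (Suc k)
        obtain m where "n = p ^ multiplicity p n * m" "\<not> p dvd m"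
          using n0 p by (metis multiplicity_decompose' not_prime_unit not_gr_zero)
        then have "int (p ^ Suc k) dvd (\<Sum>e | e dvd n. moebius_mu e * a ^ (n div e))"
          using gauss_congruence_prime_power[OF p, of m n k a] Suc by simp
        then have "p ^ Suc k dvd ?S" by (simp only: flip: int_dvd_int_iff) simp
        then show ?thesis using Suc False p
          by (intro multiplicity_geI) (auto simp: prime_gt_1_nat)
      qed simp
    qed (use n0 in auto)
  qed simp
  then have "int n dvd int ?S" by (simp only: int_dvd_int_iff)
  then show ?thesis using eq by simp
qed
lemma of_int_kappa:
  assumes "n > 0"
  shows "(of_int (kappa a n) :: 'a :: field_char_0) =
    1 / of_nat n * (\<Sum>m | m dvd n. of_int (moebius_mu (n div m)) * of_int a ^ m)"
proof -
  have "int n * kappa a n = (\<Sum>m | m dvd n. moebius_mu (n div m) * a ^ m)"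
    using gauss_congruence[OF assms] by (simp add: kappa_def)
  then have "(of_int (int n * kappa a n) :: 'a) =
      of_int (\<Sum>m | m dvd n. moebius_mu (n div m) * a ^ m)"
    by (rule arg_cong)
  then show ?thesis using assms by (simp add: field_simps)
qed

lemma necklace_map_eq:
  assumes "degree P \<le> d"
  shows "necklace_map n P = (\<Sum>a\<le>d. coeff P a * kappa (int a) n)"
  unfolding necklace_map_def
  by (rule sum.mono_neutral_left) (use assms in \<open>auto simp: coeff_eq_0\<close>)

lemma necklace_map_add: "necklace_map n (P + Q) = necklace_map n P + necklace_map n Q"
proof -
  define d where "d = max (degree P) (degree Q)"
  have "degree P \<le> d" "degree Q \<le> d" "degree (P + Q) \<le> d"
    by (auto simp: d_def degree_add_le_max)
  then show ?thesis
    by (simp add: necklace_map_eq[of _ d] sum.distrib algebra_simps)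
qed

lemma necklace_map_monom: "necklace_map n (monom c a) = c * kappa (int a) n"
proof -
  have "necklace_map n (monom c a) = (\<Sum>b\<le>a. coeff (monom c a) b * kappa (int b) n)"
    by (rule necklace_map_eq) (rule degree_monom_le)
  also have "\<dots> = (\<Sum>b\<le>a. if b = a then c * kappa (int a) n else 0)"
    by (rule sum.cong) auto
  finally show ?thesis by simp
qed

end

theory Submission
  imports Defs
begin

text \<open>
  If \<open>N(t) = \<Sum>\<^sub>k a\<^sub>k t\<^sup>k\<close>, the inner series of the zeta function is a sum of logarithms, so that the
  approximants are the products of \<open>((1 - p\<^bsup>k-s\<^esup>) / (p - 1))\<^bsup>-a\<^sub>k\<^esup>\<close>, which tend to
  \<open>(s - k)\<^bsup>-a\<^sub>k\<^esup>\<close>; the identity theorem then gives \<open>\<zeta>(s) = \<Prod>\<^sub>k (s - k)\<^bsup>-a\<^sub>k\<^esup>\<close> everywhere. With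
  \<open>x = 1/s\<close> it remains to expand each factor \<open>1 - k x\<close> by the cyclotomic identity
  \<open>1 - k x = \<Prod>\<^sub>n (1 - x\<^sup>n)\<^bsup>\<kappa>\<^sub>k(n)\<^esup>\<close>, valid for \<open>\<bar>x\<bar> < 1\<close> and \<open>k \<bar>x\<bar> < 1\<close>, which after taking
  logarithms amounts to \<open>\<Sum>\<^bsub>n | m\<^esub> n \<kappa>\<^sub>k(n) = k\<^sup>m\<close>.
\<close>

section \<open>Moebius sums and necklace numbers\<close>

text \<open>
  The Gauss congruence at \<open>a = 1\<close> makes the sum divisible by \<open>n\<close>, while it is bounded by the number of
  divisors, which is less than \<open>n\<close> for \<open>n > 2\<close>.
\<close>

lemma sum_moebius_mu_divisors:
  assumes "n > 0"
  shows "(\<Sum>d | d dvd n. moebius_mu d) = (if n = 1 then 1 else 0)"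
proof -
  let ?S = "\<Sum>d | d dvd n. moebius_mu d"
  have "?S = (\<Sum>m | m dvd n. moebius_mu (n div m) * 1 ^ m)"
    by (rule sum.reindex_bij_witness[of _ "\<lambda>e. n div e" "\<lambda>e. n div e"]) (use assms in auto)
  then have dvd: "int n dvd ?S"
    using gauss_congruence[OF assms, of 1] by simp
  consider "n = 1" | "n = 2" | "n > 2" using assms by linarith
  then show ?thesis
  proof cases
    case 1
    then show ?thesis by (simp add: moebius_mu_def)
  next
    case 2
    have "{d. d dvd n} = {1, 2::nat}"
      using 2 by (auto simp: prime_nat_iff dest: two_is_prime_nat[unfolded prime_nat_iff, THEN conjunct2, rule_format])
    moreover have "moebius_mu 2 = - moebius_mu 1"
      using moebius_mu_prime_mult[of 2 1] by simp
    ultimately show ?thesis using 2 by simp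
  next
    case 3
    \<comment> \<open>The divisors of n lie in {1..n}; one missing element, here n - 1, already
      makes their number less than n.\<close>
    have "\<not> (n - 1) dvd n"
    proof
      assume "(n - 1) dvd n"
      then have "(n - 1) dvd (n - 1) + 1" using 3 by simp
      then have "(n - 1) dvd 1" by (simp only: dvd_add_right_iff dvd_refl)
      then show False using 3 by simp
    qed
    then have "{d. d dvd n} \<subseteq> {1..n} - {n - 1}"
      using 3 by (auto dest: dvd_imp_le intro!: Suc_leI Nat.gr0I)
    then have "card {d. d dvd n} \<le> card ({1..n} - {n - 1})"
      by (intro card_mono) auto
    also have "\<dots> < n" using 3 by (subst card_Diff_subset) auto
    finally have "card {d. d dvd n} < n" .
    moreover have "\<bar>?S\<bar> \<le> (\<Sum>d | d dvd n. 1)"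
      by (rule order.trans[OF sum_abs sum_mono]) (simp add: moebius_mu_def power_abs)
    ultimately have "\<bar>?S\<bar> < int n" by simp
    then have "?S = 0" using dvd
      by (meson dvd_imp_le_int linorder_not_le abs_of_nat order.trans order_less_le_trans zdvd_not_zless dvd_abs_iff zero_less_abs_iff)
    then show ?thesis using 3 by simp
  qed
qed

text \<open>Moebius inversion. By the Gauss congruence the division in \<open>kappa\<close> is
  exact, so the left side is a double sum over chains k | m | n. Summing over m first leaves the
  divisor sum of \<open>moebius_mu\<close> on n / k, which vanishes unless k = n.\<close>

lemma sum_kappa_divisors:
  assumes "n > 0"
  shows "(\<Sum>m | m dvd n. int m * kappa a m) = a ^ n"
proof -
  have fin: "finite {m. m dvd n}" using assms by simp
  have "(\<Sum>m | m dvd n. int m * kappa a m) =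
      (\<Sum>m | m dvd n. \<Sum>k | k dvd m. moebius_mu (m div k) * a ^ k)"
    using assms by (intro sum.cong refl) (auto simp: kappa_def gauss_congruence dvd_pos_nat)
  also have "\<dots> = (\<Sum>m | m dvd n. \<Sum>k | k dvd n \<and> k dvd m. moebius_mu (m div k) * a ^ k)"
    by (intro sum.cong refl) (auto intro: dvd_trans)
  also have "\<dots> = (\<Sum>k | k dvd n. \<Sum>m | m dvd n \<and> k dvd m. moebius_mu (m div k) * a ^ k)"
    using sum.swap_restrict[OF fin fin, of "\<lambda>m k. moebius_mu (m div k) * a ^ k" "\<lambda>m k. k dvd m"]
    by simp
  also have "\<dots> = (\<Sum>k | k dvd n. if k = n then a ^ n else 0)"
  proof (intro sum.cong refl)
    fix k assume "k \<in> {k. k dvd n}"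
    then obtain l where l: "n = k * l" by auto
    have k: "k > 0" "l > 0" using l assms by auto
    have "(\<Sum>m | m dvd n \<and> k dvd m. moebius_mu (m div k) * a ^ k) =
        (\<Sum>d | d dvd l. moebius_mu d * a ^ k)"
      by (rule sum.reindex_bij_witness[of _ "\<lambda>d. k * d" "\<lambda>m. m div k"]) (use l k in auto)
    also have "\<dots> = (\<Sum>d | d dvd l. moebius_mu d) * a ^ k"
      by (simp add: sum_distrib_right)
    also have "\<dots> = (if k = n then a ^ n else 0)"
      using sum_moebius_mu_divisors[OF k(2)] l k by (cases "l = 1") auto
    finally show "(\<Sum>m | m dvd n \<and> k dvd m. moebius_mu (m div k) * a ^ k) =
      (if k = n then a ^ n else 0)" .
  qed
  also have "\<dots> = a ^ n" using fin by simp
  finally show ?thesis .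
qed

text \<open>Only positive powers of 0 occur. Hence the constant coefficient of a polynomial does not
  enter the exponents of the necklace product.\<close>

lemma kappa_0_left: "n > 0 \<Longrightarrow> kappa 0 n = 0"
proof -
  assume "n > 0"
  then have "(\<Sum>m | m dvd n. moebius_mu (n div m) * 0 ^ m) = 0"
    by (intro sum.neutral) (auto simp: power_0_left)
  then show ?thesis by (simp add: kappa_def)
qed

text \<open>At most n divisors contribute, each at most a^n in absolute value; the division by n
  absorbs their number.\<close>

lemma abs_kappa_le:
  assumes "n > 0"
  shows "\<bar>kappa (int a) n\<bar> \<le> int a ^ n"
proof (cases "a = 0")
  case True
  then show ?thesis using assms by (simp add: kappa_0_left)
next
  case False
  have "int n * kappa (int a) n = (\<Sum>m | m dvd n. moebius_mu (n div m) * int a ^ m)"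
    using gauss_congruence[OF assms] by (simp add: kappa_def)
  then have "int n * \<bar>kappa (int a) n\<bar> = \<bar>\<Sum>m | m dvd n. moebius_mu (n div m) * int a ^ m\<bar>"
    by (metis abs_mult abs_of_nat)
  also have "\<dots> \<le> (\<Sum>m | m dvd n. int a ^ n)"
  proof (rule order.trans[OF sum_abs sum_mono])
    fix m assume "m \<in> {m. m dvd n}"
    then have "int a ^ m \<le> int a ^ n"
      using assms False by (intro power_increasing) (auto dest: dvd_imp_le)
    moreover have "\<bar>moebius_mu (n div m)\<bar> \<le> 1" by (simp add: moebius_mu_def power_abs)
    ultimately show "\<bar>moebius_mu (n div m) * int a ^ m\<bar> \<le> int a ^ n"
      using mult_mono[of "\<bar>moebius_mu (n div m)\<bar>" 1 "int a ^ m" "int a ^ n"]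
      by (simp add: abs_mult power_abs)
  qed
  also have "\<dots> \<le> int n * int a ^ n"
  proof -
    have "card {m. m dvd n} \<le> card {1..n}"
      using assms by (intro card_mono) (auto dest: dvd_imp_le dvd_pos_nat simp: Suc_le_eq)
    then show ?thesis by (simp add: mult_right_mono)
  qed
  finally show ?thesis using assms by simp
qed

section \<open>Logarithm of the cyclotomic identity\<close>

text \<open>The logarithm series in unconditional form, as needed to regroup double series.\<close>

lemma has_sum_minus_Ln:
  fixes w :: complex
  assumes "norm w < 1"
  shows "((\<lambda>j. w ^ j / of_nat j) has_sum - Ln (1 - w)) {1..}"
proof -
  have "(\<lambda>j. w ^ j / of_nat j) sums - Ln (1 - w)"
    using sums_minus[OF Ln_series'[of "- w"]] assms by simp
  moreover have "summable (\<lambda>j. norm (w ^ j / of_nat j))"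
  proof (rule summable_comparison_test')
    show "summable (\<lambda>j. norm w ^ j)" using assms by simp
    show "norm (norm (w ^ j / of_nat j)) \<le> norm w ^ j" if "j \<ge> 0" for j
      using divide_left_mono[of 1 "real j" "norm w ^ j"]
      by (cases "j = 0") (auto simp: norm_divide norm_power)
  qed
  ultimately have "((\<lambda>j. w ^ j / of_nat j) has_sum - Ln (1 - w)) UNIV"
    by (rule norm_summable_imp_has_sum[rotated])
  \<comment> \<open>The term at j = 0 is a division by 0 and hence 0.\<close>
  then show ?thesis
    by (rule has_sum_cong_neutral[THEN iffD1, rotated -1]) (auto simp: not_le)
qed

text \<open>Since n j >= n + (j - 1) for n, j >= 1, the bound |kappa| <= a^n gives the majorant (a
  |x|)^n |x|^(j - 1), a product of two geometric series, one for each hypothesis on x.\<close>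

lemma summable_on_kappa_Lambert:
  fixes x :: complex
  assumes x: "norm x < 1" "real a * norm x < 1"
  shows "(\<lambda>(n, j). of_int (kappa (int a) n) * ((x ^ n) ^ j / of_nat j)) summable_on {1..} \<times> {1..}"
proof (rule abs_summable_summable, rule Infinite_Sum.abs_summable_on_comparison_test')
  let ?r = "norm x"
  have geo: "((\<lambda>j. ?r ^ (j - 1)) has_sum 1 / (1 - ?r)) {1..}"
  proof -
    have "((\<lambda>j. ?r ^ j) has_sum 1 / (1 - ?r)) UNIV"
      using x by (intro norm_summable_imp_has_sum geometric_sums) auto
    then show ?thesis
      by (subst has_sum_reindex_bij_witness[of UNIV "\<lambda>j. j - 1" Suc "{1..}" _ "\<lambda>j. ?r ^ j", symmetric]) auto
  qed
  show "(\<lambda>(n, j). (real a * ?r) ^ n * ?r ^ (j - 1)) summable_on {1..} \<times> {1..}"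
  proof (rule summable_on_SigmaI)
    show "((\<lambda>j. (case (n, j) of (n, j) \<Rightarrow> (real a * ?r) ^ n * ?r ^ (j - 1))) has_sum
        (real a * ?r) ^ n * (1 / (1 - ?r))) {1..}" for n :: nat
      using has_sum_cmult_right[OF geo] by simp
    have "(\<lambda>n. (real a * ?r) ^ n) summable_on UNIV"
      using x by (intro norm_summable_imp_summable_on) (simp add: abs_mult)
    then have "(\<lambda>n. (real a * ?r) ^ n) summable_on {1..}"
      by (rule summable_on_subset_banach) auto
    then show "(\<lambda>n. (real a * ?r) ^ n * (1 / (1 - ?r))) summable_on {1..}"
      by (rule summable_on_cmult_left)
  qed auto
  fix z :: "nat \<times> nat" assume "z \<in> {1..} \<times> {1..}"
  then obtain n j where z: "z = (n, j)" "n \<ge> 1" "j \<ge> 1" by auto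
  have "n + (j - 1) \<le> n * j"
    using z by (cases j; cases n) auto
  then have "?r ^ (n * j) \<le> ?r ^ n * ?r ^ (j - 1)"
    using x unfolding power_add[symmetric] by (intro power_decreasing) auto
  moreover have "\<bar>real_of_int (kappa (int a) n)\<bar> \<le> real a ^ n"
  proof -
    have "real_of_int \<bar>kappa (int a) n\<bar> \<le> real_of_int (int a ^ n)"
      using z abs_kappa_le[of n a] by (subst of_int_le_iff) auto
    then show ?thesis by simp
  qed
  ultimately have "\<bar>real_of_int (kappa (int a) n)\<bar> * (?r ^ (n * j) / real j) \<le>
      real a ^ n * (?r ^ n * ?r ^ (j - 1) / 1)"
    using z by (intro mult_mono frac_le) auto
  then show "norm (case z of (n, j) \<Rightarrow> complex_of_int (kappa (int a) n) * ((x ^ n) ^ j / of_nat j))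
      \<le> (case z of (n, j) \<Rightarrow> (real a * ?r) ^ n * ?r ^ (j - 1))"
    using z by (simp add: norm_mult norm_divide norm_power power_mult power_mult_distrib mult.assoc)
qed

text \<open>The logarithm of the cyclotomic identity; both sides are the same double series, summed
  over pairs \<open>(n, j)\<close> and over the divisors \<open>n\<close> of \<open>n j\<close>.\<close>

lemma has_sum_kappa_Ln:
  fixes x :: complex
  assumes x: "norm x < 1" "real a * norm x < 1"
  shows "((\<lambda>n. of_int (kappa (int a) n) * - Ln (1 - x ^ n)) has_sum - Ln (1 - of_nat a * x)) {1..}"
proof -
  define F where "F = (\<lambda>(n, j). of_int (kappa (int a) n) * ((x ^ n) ^ j / of_nat j))"
  obtain S where S: "(F has_sum S) ({1..} \<times> {1..})"
    using summable_on_kappa_Lambert[OF x]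
    unfolding F_def[symmetric] summable_on_def by blast
  have 1: "((\<lambda>n. of_int (kappa (int a) n) * - Ln (1 - x ^ n)) has_sum S) {1..}"
  proof (rule has_sum_Sigma'[OF S])
    fix n :: nat assume "n \<in> {1..}"
    then have "norm (x ^ n) < 1" using x by (simp add: norm_power power_less_one_iff)
    from has_sum_cmult_right[OF has_sum_minus_Ln[OF this]]
    show "((\<lambda>j. F (n, j)) has_sum of_int (kappa (int a) n) * - Ln (1 - x ^ n)) {1..}"
      unfolding F_def by simp
  qed
  \<comment> \<open>Regroup by k = n j, with the divisor n as the coordinate in the fibre.\<close>
  have "((\<lambda>(k, n). F (n, k div n)) has_sum S) (SIGMA k:{1..}. {n. n dvd k})"
    by (rule has_sum_reindex_bij_witness[of _ "\<lambda>(n, j). (n * j, n)" "\<lambda>(k, n). (n, k div n)"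
          "{1..} \<times> {1..}" F, THEN iffD2])
       (use S in \<open>auto simp: Suc_le_eq dvd_pos_nat intro!: Nat.gr0I\<close>)
  then have "((\<lambda>k. (of_nat a * x) ^ k / of_nat k) has_sum S) {1..}"
  proof (rule has_sum_Sigma')
    fix k :: nat assume "k \<in> {1..}"
    then have k: "k > 0" by simp
    \<comment> \<open>In the fibre over k every term carries x^k, and 1 / j = n / k supplies the
      weight n required by \<open>sum_kappa_divisors\<close>.\<close>
    have "(of_nat a * x) ^ k / of_nat k =
        of_int (\<Sum>n | n dvd k. int n * kappa (int a) n) * x ^ k / of_nat k"
      by (simp add: sum_kappa_divisors[OF k] power_mult_distrib del: of_int_sum)
    also have "\<dots> = (\<Sum>n | n dvd k. F (n, k div n))"
      unfolding of_int_sum sum_distrib_right sum_divide_distrib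
    proof (intro sum.cong refl)
      fix n assume "n \<in> {n. n dvd k}"
      then obtain j where j: "k = n * j" by auto
      then show "of_int (int n * kappa (int a) n) * x ^ k / of_nat k = F (n, k div n)"
        using k by (simp add: F_def field_simps flip: power_mult)
    qed
    finally show "((\<lambda>n. case (k, n) of (k, n) \<Rightarrow> F (n, k div n)) has_sum
        (of_nat a * x) ^ k / of_nat k) {n. n dvd k}"
      using k by (intro has_sum_finiteI) auto
  qed
  moreover have "norm (of_nat a * x) < 1" using x by (simp add: norm_mult)
  ultimately have "S = - Ln (1 - of_nat a * x)"
    using has_sum_minus_Ln has_sum_unique by blast
  then show ?thesis using 1 by simp
qed

section \<open>Uniqueness and niceness of meromorphic functions\<close>

lemma nicely_meromorphic_on_UNIV_eqI:
  assumes f: "f nicely_meromorphic_on UNIV" and g: "g nicely_meromorphic_on UNIV"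
    and eq: "frequently (\<lambda>z. f z = g z) (at z0)"
  shows "f = g"
proof
  fix z
  define h where "h = (\<lambda>z. f z - g z)"
  have mero: "h meromorphic_on UNIV"
    using f g unfolding h_def nicely_meromorphic_on_def by (intro meromorphic_intros) auto
  \<comment> \<open>Where poles of \<open>f\<close> and \<open>g\<close> cancel, \<open>h\<close>
    itself may fail to be nice, so the identity theorem is applied after removing its
    singularities.\<close>
  have ev: "eventually (\<lambda>w. remove_sings h w = h w) (at w0)" for w0
    using eventually_remove_sings_eq[OF mero] by (simp add: eventually_cosparse_open_eq)
  have "frequently (\<lambda>w. remove_sings h w = 0) (at z0)"
    using frequently_eventually_frequently[OF eq ev] by (rule frequently_elim1) (auto simp: h_def)
  then have "remove_sings h w = 0" for w :: complex
    by (rule frequently_eq_meromorphic_imp_constant[OF _ remove_sings_nicely_meromorphic[OF mero]]) auto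
  then have fg: "eventually (\<lambda>w. f w = g w) (at z)"
    using ev[of z] by (auto simp: h_def elim!: eventually_mono)
  \<comment> \<open>Agreement on a punctured neighbourhood fixes the value at z too: niceness makes
    it the limit, or 0 at a pole.\<close>
  then have "is_pole f z \<longleftrightarrow> is_pole g z" by (intro is_pole_cong) auto
  moreover have "f \<midarrow>z\<rightarrow> c \<longleftrightarrow> g \<midarrow>z\<rightarrow> c" for c
    using fg by (intro filterlim_cong) auto
  moreover have "\<not> is_pole f z" if "f \<midarrow>z\<rightarrow> c" for c
    using not_tendsto_and_filterlim_at_infinity[OF at_neq_bot that] by (auto simp: is_pole_def)
  moreover have "is_pole f z \<and> f z = 0 \<or> f \<midarrow>z\<rightarrow> f z" "is_pole g z \<and> g z = 0 \<or> g \<midarrow>z\<rightarrow> g z"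
    using f g by (auto simp: nicely_meromorphic_on_def)
  ultimately show "f z = g z" using LIM_unique[of f "f z" z "g z"] by auto
qed

lemma nicely_meromorphic_prod_powi:
  fixes c :: "nat \<Rightarrow> int"
  assumes "finite A"
  shows "(\<lambda>s. \<Prod>k\<in>A. (s - of_nat k) powi c k) nicely_meromorphic_on UNIV"
  unfolding nicely_meromorphic_on_def
proof (intro conjI ballI)
  let ?Z = "\<lambda>s::complex. \<Prod>k\<in>A. (s - of_nat k) powi c k"
  show "?Z meromorphic_on UNIV" by (intro meromorphic_intros)
  fix z :: complex
  show "is_pole ?Z z \<and> ?Z z = 0 \<or> ?Z \<midarrow>z\<rightarrow> ?Z z"
  proof (cases "\<exists>k\<in>A. z = of_nat k \<and> c k < 0")
    case False
    have "(\<lambda>s. (s - of_nat k) powi c k) \<midarrow>z\<rightarrow> (z - of_nat k) powi c k" if "k \<in> A" for k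
    proof (cases "z = of_nat k")
      case True
      with False that have "c k \<ge> 0" by force
      then show ?thesis by (auto simp: power_int_def intro!: tendsto_intros)
    qed (auto intro!: tendsto_intros)
    then have "?Z \<midarrow>z\<rightarrow> ?Z z" by (intro tendsto_prod) auto
    then show ?thesis ..
  next
    case True
    then obtain k where k: "k \<in> A" "z = of_nat k" "c k < 0" by auto
    \<comment> \<open>The points k are distinct, so the other factors are analytic and nonzero at z
      and cannot cancel the pole. The value 0 required there comes from
      \<open>0 powi c k = 0\<close> for negative exponents.\<close>
    define g where "g = (\<lambda>s::complex. \<Prod>j\<in>A-{k}. (s - of_nat j) powi c j)"
    have Z: "?Z = (\<lambda>s. (s - of_nat k) powi c k * g s)"
      using assms k by (auto simp: g_def prod.remove)
    have "g analytic_on {z}"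
      unfolding g_def using k by (intro analytic_intros) auto
    moreover have "g z \<noteq> 0" using k assms by (auto simp: g_def)
    moreover have "is_pole (\<lambda>s. (s - of_nat k) powi c k) z"
    proof -
      have "(\<lambda>s::complex. (s - of_nat k) powi c k) = (\<lambda>s. 1 / (s - z) ^ nat (- c k))"
        using k by (auto simp: power_int_def field_simps)
      then show ?thesis using is_pole_inverse_power[of "nat (- c k)" z] k by simp
    qed
    ultimately have "is_pole ?Z z"
      unfolding Z by (intro is_pole_mult_analytic_nonzero2) auto
    moreover have "?Z z = 0" using assms k by auto
    ultimately show ?thesis by blast
  qed
qed

section \<open>The absolute zeta function as a finite product\<close>

lemma sum_coeff_eq_poly_1:
  fixes N :: "'a :: comm_semiring_1 poly"
  shows "(\<Sum>k\<le>degree N. coeff N k) = poly N 1"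
  by (simp add: poly_altdef)

lemma power_int_sum:
  fixes x :: "'a :: field"
  assumes "x \<noteq> 0"
  shows "x powi (\<Sum>k\<in>A. f k) = (\<Prod>k\<in>A. x powi f k)"
  by (induction A rule: infinite_finite_induct) (use assms in \<open>auto simp: power_int_add\<close>)

text \<open>Integer multiples of a logarithm exponentiate independently of the branch, so sums of
  \<open>Ln\<close> turn into products of integer powers.\<close>

lemma exp_of_int_mult_Ln: "w \<noteq> 0 \<Longrightarrow> exp (of_int c * Ln w) = w powi c"
  using exp_power_int[of "Ln w" c] by (simp add: mult.commute)

text \<open>Up to sign this is the difference quotient at 1 of w powr (c - s), whose derivative
  there is c - s.\<close>

lemma tendsto_one_minus_powr_over:
  fixes s :: complex
  shows "((\<lambda>p::real. (1 - of_real p powr (c - s)) / (of_real p - 1)) \<longlongrightarrow> s - c) (at_right 1)"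
proof -
  have "((\<lambda>w. w powr (c - s)) has_field_derivative (c - s)) (at 1)"
    by (auto intro!: derivative_eq_intros)
  then have "((\<lambda>w. (w powr (c - s) - 1) / (w - 1)) \<longlongrightarrow> c - s) (at 1)"
    by (simp add: has_field_derivative_iff)
  moreover have "filterlim complex_of_real (at 1) (at_right 1)"
    by (auto simp: filterlim_at eventually_at_filter intro!: tendsto_eq_intros)
  ultimately have "((\<lambda>p::real. (of_real p powr (c - s) - 1) / (of_real p - 1)) \<longlongrightarrow> c - s) (at_right 1)"
    by (rule filterlim_compose)
  from tendsto_minus[OF this] show ?thesis unfolding minus_divide_left by simp
qed

text \<open>With q_k = p^(k - s) the coefficient of t^k contributes a logarithm series in q_k, and
  |q_k| < 1 because Re s > k. The exponent N(1) is the sum of the coefficients, so the prefactor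
  splits over the factors.\<close>

lemma zeta_approx_eq:
  assumes p: "p > 1" and s: "Re s > real (degree N)"
  shows "zeta_approx N s p =
    (\<Prod>k\<le>degree N. ((1 - of_real p powr (of_nat k - s)) / (of_real p - 1)) powi (- coeff N k))"
proof -
  let ?q = "\<lambda>k. complex_of_real p powr (of_nat k - s)"
  have q: "norm (?q k) < 1" if "k \<le> degree N" for k
  proof -
    have "norm (?q k) = p powr (real k - Re s)"
      using p by (simp add: norm_powr_real_powr)
    also have "\<dots> < p powr 0" using that p s by (intro powr_less_mono) auto
    finally show ?thesis using p by simp
  qed
  have "(\<lambda>m. \<Sum>k\<le>degree N. of_int (coeff N k) * (?q k ^ Suc m / of_nat (Suc m))) sums
      (\<Sum>k\<le>degree N. of_int (coeff N k) * - Ln (1 - ?q k))"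
  proof (intro sums_sum sums_mult)
    fix k assume "k \<in> {..degree N}"
    then have "norm (- ?q k) < 1" using q by simp
    from sums_minus[OF Ln_series'[OF this]]
    have "(\<lambda>m. ?q k ^ m / of_nat m) sums - Ln (1 - ?q k)" by simp
    \<comment> \<open>The shift keeps the sum, as the term at index 0 is 0.\<close>
    then show "(\<lambda>m. ?q k ^ Suc m / of_nat (Suc m)) sums - Ln (1 - ?q k)"
      by (subst sums_Suc_iff) simp
  qed
  moreover have "(\<Sum>k\<le>degree N. of_int (coeff N k) * (?q k ^ Suc m / of_nat (Suc m))) =
      poly (map_poly of_int N) (of_real p ^ Suc m) / of_nat (Suc m) *
        of_real p powr (- s * of_nat (Suc m))" for m
  proof -
    have "?q k ^ Suc m = (of_real p ^ Suc m) ^ k * of_real p powr (- s * of_nat (Suc m))" for k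
    proof -
      have "?q k ^ Suc m = of_real p powr (of_nat (Suc m) * (of_nat k - s))"
        using p by (intro powr_power) auto
      also have "of_nat (Suc m) * (of_nat k - s) = of_nat (Suc m * k) + - s * of_nat (Suc m)"
        unfolding of_nat_mult right_diff_distrib by simp
      also have "of_real p powr \<dots> = of_real p ^ (Suc m * k) * of_real p powr (- s * of_nat (Suc m))"
        using p by (subst powr_add, subst powr_nat') auto
      finally show ?thesis by (simp only: power_mult)
    qed
    then show ?thesis
      unfolding poly_altdef sum_divide_distrib sum_distrib_right
      by (simp add: degree_map_poly coeff_map_poly mult.assoc del: power_Suc of_nat_Suc)
  qed
  ultimately have "(\<Sum>m. poly (map_poly of_int N) (of_real p ^ Suc m) / of_nat (Suc m) *
      of_real p powr (- s * of_nat (Suc m))) = (\<Sum>k\<le>degree N. of_int (- coeff N k) * Ln (1 - ?q k))"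
    by (simp add: sums_iff)
  also have "exp \<dots> = (\<Prod>k\<le>degree N. exp (of_int (- coeff N k) * Ln (1 - ?q k)))"
    by (rule exp_sum) simp
  also have "\<dots> = (\<Prod>k\<le>degree N. (1 - ?q k) powi (- coeff N k))"
    using q by (intro prod.cong refl exp_of_int_mult_Ln) fastforce
  finally have "zeta_approx N s p =
      (of_real p - 1) powi (\<Sum>k\<le>degree N. coeff N k) * (\<Prod>k\<le>degree N. (1 - ?q k) powi (- coeff N k))"
    by (simp add: zeta_approx_def sum_coeff_eq_poly_1)
  also have "(of_real p - 1) powi (\<Sum>k\<le>degree N. coeff N k) =
      (\<Prod>k\<le>degree N. (complex_of_real p - 1) powi coeff N k)"
    using p by (intro power_int_sum) auto
  finally have "zeta_approx N s p = (\<Prod>k\<le>degree N.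
      (of_real p - 1) powi coeff N k * (1 - ?q k) powi (- coeff N k))"
    by (simp only: prod.distrib)
  also have "\<dots> = (\<Prod>k\<le>degree N. ((1 - ?q k) / (of_real p - 1)) powi (- coeff N k))"
    using p by (intro prod.cong refl) (simp add: power_int_minus power_int_inverse power_int_mult_distrib divide_inverse)
  finally show ?thesis .
qed

lemma absolute_zeta_eq_prod:
  "absolute_zeta N = (\<lambda>s. \<Prod>k\<le>degree N. (s - of_nat k) powi (- coeff N k))"
proof -
  define Z where "Z = (\<lambda>s::complex. \<Prod>k\<le>degree N. (s - of_nat k) powi (- coeff N k))"
  have mero: "Z nicely_meromorphic_on UNIV"
    unfolding Z_def by (rule nicely_meromorphic_prod_powi) simp
  have lim: "(zeta_approx N s \<longlongrightarrow> Z s) (at_right 1)" if s: "Re s > real (degree N)" for s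
  proof -
    have "((\<lambda>p. \<Prod>k\<le>degree N.
        ((1 - of_real p powr (of_nat k - s)) / (of_real p - 1)) powi (- coeff N k)) \<longlongrightarrow> Z s) (at_right 1)"
      unfolding Z_def using s by (intro tendsto_prod tendsto_power_int tendsto_one_minus_powr_over) auto
    moreover have "eventually (\<lambda>p. zeta_approx N s p = (\<Prod>k\<le>degree N.
        ((1 - of_real p powr (of_nat k - s)) / (of_real p - 1)) powi (- coeff N k))) (at_right 1)"
      using eventually_at_right_less[of "1::real"] by eventually_elim (rule zeta_approx_eq[OF _ s])
    ultimately show ?thesis using tendsto_cong by fastforce
  qed
  have "absolute_zeta N = Z"
    unfolding absolute_zeta_def
  proof (rule the_equality)
    show "Z nicely_meromorphic_on UNIV \<and>
        (\<forall>s. Re s > real (degree N) \<longrightarrow> (zeta_approx N s \<longlongrightarrow> Z s) (at_right 1))"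
      using mero lim by blast
    fix Y assume Y: "Y nicely_meromorphic_on UNIV \<and>
        (\<forall>s. Re s > real (degree N) \<longrightarrow> (zeta_approx N s \<longlongrightarrow> Y s) (at_right 1))"
    then have "Y s = Z s" if "Re s > real (degree N)" for s
      using tendsto_unique[OF _ _ lim[OF that]] that by auto
    \<comment> \<open>Any point of the half-plane would serve; equality near it feeds the identity
      theorem.\<close>
    moreover have "eventually (\<lambda>s. s \<in> {s. Re s > real (degree N)}) (at (of_nat (Suc (degree N))))"
      by (intro eventually_at_in_open' open_halfspace_Re_gt) auto
    ultimately have "frequently (\<lambda>s. Y s = Z s) (at (of_nat (Suc (degree N))))"
      by (intro eventually_frequently) (auto elim: eventually_mono)
    then show "Y = Z" using Y mero nicely_meromorphic_on_UNIV_eqI by blast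
  qed
  then show ?thesis by (simp add: Z_def)
qed

section \<open>The infinite necklace product\<close>

text \<open>The terms tend to 0, and |exp z - 1| <= 2 |z| for small z, so the deviations of the
  factors from 1 are absolutely summable.\<close>

lemma abs_convergent_prod_exp:
  fixes g :: "nat \<Rightarrow> complex"
  assumes "summable (\<lambda>n. norm (g n))"
  shows "abs_convergent_prod (\<lambda>n. exp (g n))"
proof (rule summable_imp_abs_convergent_prod, rule summable_comparison_test_ev)
  have "(\<lambda>n. norm (g n)) \<longlonglongrightarrow> 0" using assms by (rule summable_LIMSEQ_zero)
  then have "eventually (\<lambda>n. norm (g n) < 1/2) sequentially" by (rule order_tendstoD) simp
  then show "eventually (\<lambda>n. norm (norm (exp (g n) - 1)) \<le> 2 * norm (g n)) sequentially"
  proof eventually_elim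
    case (elim n)
    show ?case using norm_exp_bounds(2)[of "g n"] norm_ge_zero[of "g n"] elim
      unfolding real_norm_def abs_norm_cancel by linarith
  qed
  show "summable (\<lambda>n. 2 * norm (g n))" using assms by (rule summable_mult)
qed

lemma has_sum_finite_sum:
  fixes f :: "'i \<Rightarrow> 'b \<Rightarrow> 'a :: topological_comm_monoid_add"
  assumes "finite I" "\<And>i. i \<in> I \<Longrightarrow> (f i has_sum c i) A"
  shows "((\<lambda>x. \<Sum>i\<in>I. f i x) has_sum (\<Sum>i\<in>I. c i)) A"
  using assms by (induction I rule: finite_induct) (auto intro!: has_sum_add)

text \<open>The exponents are linear in the coefficients of \<open>N\<close>, so the logarithms
  combine those of the cyclotomic identities for k <= \<open>degree N\<close>; exponentiating gives
  the product.\<close>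

lemma necklace_product:
  fixes x :: complex
  assumes x: "norm x < 1" "real (degree N) * norm x < 1"
  shows "abs_convergent_prod (\<lambda>n. (1 - x ^ Suc n) powi (- necklace_map (Suc n) N))"
    and "(\<Prod>n. (1 - x ^ Suc n) powi (- necklace_map (Suc n) N)) =
      (\<Prod>k\<le>degree N. (1 - of_nat k * x) powi (- coeff N k))"
proof -
  define g where "g = (\<lambda>n. of_int (- necklace_map n N) * Ln (1 - x ^ n))"
  have kx: "real k * norm x < 1" if "k \<le> degree N" for k
    using that x(2) mult_right_mono[of "real k" "real (degree N)" "norm x"] by simp
  have ne: "1 - w \<noteq> 0" if "norm w < 1" for w :: complex
    using that by auto
  have "((\<lambda>n. \<Sum>k\<le>degree N. of_int (coeff N k) * (of_int (kappa (int k) n) * - Ln (1 - x ^ n)))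
      has_sum (\<Sum>k\<le>degree N. of_int (coeff N k) * - Ln (1 - of_nat k * x))) {1..}"
    by (intro has_sum_finite_sum has_sum_cmult_right has_sum_kappa_Ln x kx) auto
  moreover have "(\<lambda>n. \<Sum>k\<le>degree N. of_int (coeff N k) * (of_int (kappa (int k) n) * - Ln (1 - x ^ n))) = g"
    by (simp add: g_def necklace_map_def sum_distrib_right sum_negf mult.assoc)
  ultimately have "(g has_sum (\<Sum>k\<le>degree N. of_int (- coeff N k) * Ln (1 - of_nat k * x))) {1..}"
    by simp
  then have sum: "((\<lambda>n. g (Suc n)) has_sum
      (\<Sum>k\<le>degree N. of_int (- coeff N k) * Ln (1 - of_nat k * x))) UNIV"
    by (subst has_sum_reindex_bij_witness[of UNIV "\<lambda>n. n - 1" Suc "{1..}" g]) auto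
  \<comment> \<open>For complex series unconditional and absolute summability coincide.\<close>
  have "(\<lambda>n. norm (g (Suc n))) summable_on UNIV"
    using sum by (simp add: has_sum_imp_summable flip: summable_on_iff_abs_summable_on_complex)
  then have abs: "summable (\<lambda>n. norm (g (Suc n)))"
    by (rule summable_on_imp_summable)
  have exp_g: "exp (g (Suc n)) = (1 - x ^ Suc n) powi (- necklace_map (Suc n) N)" for n
    unfolding g_def using x
    by (intro exp_of_int_mult_Ln ne) (simp add: norm_power power_less_one_iff del: power_Suc)
  show "abs_convergent_prod (\<lambda>n. (1 - x ^ Suc n) powi (- necklace_map (Suc n) N))"
    using abs_convergent_prod_exp[OF abs] by (simp only: exp_g)
  have "(\<Prod>n. exp (g (Suc n))) = exp (\<Sum>n. g (Suc n))"
    by (rule prodinf_exp[OF summable_norm_cancel[OF abs]])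
  also have "(\<Sum>n. g (Suc n)) = (\<Sum>k\<le>degree N. of_int (- coeff N k) * Ln (1 - of_nat k * x))"
    using has_sum_imp_sums[OF sum] by (simp only: sums_iff)
  also have "exp \<dots> = (\<Prod>k\<le>degree N. exp (of_int (- coeff N k) * Ln (1 - of_nat k * x)))"
    by (rule exp_sum) simp
  also have "\<dots> = (\<Prod>k\<le>degree N. (1 - of_nat k * x) powi (- coeff N k))"
    using kx by (intro prod.cong refl exp_of_int_mult_Ln ne) (auto simp: norm_mult)
  finally show "(\<Prod>n. (1 - x ^ Suc n) powi (- necklace_map (Suc n) N)) =
      (\<Prod>k\<le>degree N. (1 - of_nat k * x) powi (- coeff N k))"
    by (simp only: exp_g)
qed

text \<open>Write s - k = s (1 - k / s); the powers of s collect to the exponent -N(1).\<close>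

lemma absolute_zeta_eq_powi_mult_prod:
  assumes "s \<noteq> 0"
  shows "absolute_zeta N s = (1 / s) powi (poly N 1) *
    (\<Prod>k\<le>degree N. (1 - of_nat k * (1 / s)) powi (- coeff N k))"
proof -
  have "(1 / s) powi (poly N 1) = (\<Prod>k\<le>degree N. (1 / s) powi coeff N k)"
    using assms power_int_sum[of "1 / s" "coeff N" "{..degree N}"] by (simp add: sum_coeff_eq_poly_1)
  also have "\<dots> = (\<Prod>k\<le>degree N. s powi (- coeff N k))"
    by (intro prod.cong refl) (simp add: power_int_minus power_int_inverse power_int_mult_distrib divide_inverse)
  finally have "(1 / s) powi (poly N 1) *
      (\<Prod>k\<le>degree N. (1 - of_nat k * (1 / s)) powi (- coeff N k)) =
      (\<Prod>k\<le>degree N. (s * (1 - of_nat k * (1 / s))) powi (- coeff N k))"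
    by (simp only: power_int_mult_distrib prod.distrib)
  also have "\<dots> = (\<Prod>k\<le>degree N. (s - of_nat k) powi (- coeff N k))"
    using assms by (intro prod.cong refl) (simp add: right_diff_distrib)
  finally show ?thesis by (simp add: absolute_zeta_eq_prod)
qed

theorem corollary3p13:
  fixes \<X> :: "('u, 'x) MR_functor"
    and XM :: "('p, 's) monoidal_space"
    and XZ :: "('q, 't) ringed_space"
    and N :: "int poly"
  assumes "noetherian_F1_scheme \<X> XM XZ"
    and "torsion_free_F1_scheme XM"
    and "N = counting_function XM"
  shows "\<forall>s::complex. norm s > real (degree N) \<longrightarrow>
    abs_convergent_prod (\<lambda>n. (1 - (1 / s) ^ Suc n) powi (- necklace_map (Suc n) N)) \<and>
    absolute_zeta N s =
      (1 / s) powi (poly N 1) *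
      (\<Prod>n. (1 - (1 / s) ^ Suc n) powi (- necklace_map (Suc n) N))"
proof (intro allI impI)
  fix s :: complex assume s: "norm s > real (degree N)"
  then have s0: "s \<noteq> 0" by auto
  show "abs_convergent_prod (\<lambda>n. (1 - (1 / s) ^ Suc n) powi (- necklace_map (Suc n) N)) \<and>
    absolute_zeta N s = (1 / s) powi (poly N 1) *
      (\<Prod>n. (1 - (1 / s) ^ Suc n) powi (- necklace_map (Suc n) N))"
  proof (cases "degree N = 0")
    case True
    \<comment> \<open>Here \<open>1 / s\<close> may lie outside the unit disc, but all factors are 1.\<close>
    then have "necklace_map (Suc n) N = 0" for n
      by (simp add: necklace_map_def kappa_0_left)
    moreover have "abs_convergent_prod (\<lambda>n. 1 :: complex)"
      by (rule summable_imp_abs_convergent_prod) simp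
    ultimately show ?thesis
      using True by (simp add: absolute_zeta_eq_powi_mult_prod[OF s0])
  next
    case False
    \<comment> \<open>As the degree is at least 1 here, norm s > \<open>degree N\<close> also forces
      norm s > 1.\<close>
    have "norm (1 / s) < 1" "real (degree N) * norm (1 / s) < 1"
      using s s0 False by (auto simp: norm_divide field_simps)
    from necklace_product[OF this] show ?thesis
      by (simp only: absolute_zeta_eq_powi_mult_prod[OF s0])
  qed
qed

end
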